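(* Let $\mathcal F$ be a semifilter, let $S=\{f_\alpha : \alpha<\mathfrak b(\mathcal F)\}$ be a $\mathfrak b(\mathcal F)$-scale, and let $X=S\cup Q$, viewed as a subspace of $\overline{\mathbb N}^{\uparrow\mathbb N}$. Then $X$ does not contain a perfect subset (that is, no nonempty closed subset of $\overline{\mathbb N}^{\uparrow\mathbb N}$ without isolated points is contained in $X$). In particular, $X$ is not $\sigma$-compact.
   Context: $\mathbb N=\{0,1,2,\dots\}$, discrete; $\mathbb N^{\mathbb N}$ has the product topology. $[\mathbb N]^{\aleph_0}$ is the family of infinite subsets of $\mathbb N$; $A\subseteq^*B$ means $A\setminus B$ is finite. A semifilter is a nonempty $\mathcal F\subseteq[\mathbb N]^{\aleph_0}$ such that $A\in\mathcal F$, $B\subseteq\mathbb N$ and $A\subseteq^*B$ imply $B\in\mathcal F$. For $f,g\in\mathbb N^{\mathbb N}$, $f\le_{\mathcal F}g$ means $\{n:f(n)\le g(n)\}\in\mathcal F$. A set $Y\subseteq\mathbb N^{\mathbb N}$ is bounded with respect to $\le_{\mathcal F}$ if there is $g\in\mathbb N^{\mathbb N}$ with $f\le_{\mathcal F}g$ for all $f\in Y$; otherwise it is unbounded. $\mathfrak b(\mathcal F)$ is the minimal cardinality of a subset of $\mathbb N^{\mathbb N}$ that is unbounded with respect to $\le_{\mathcal F}$. $\mathbb N^{\uparrow\mathbb N}$ is the set of (strictly) increasing elements of $\mathbb N^{\mathbb N}$. A $\mathfrak b(\mathcal F)$-scale is a family $S=\{f_\alpha:\alpha<\mathfrak b(\mathcal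 F)\}\subseteq\mathbb N^{\uparrow\mathbb N}$ that is unbounded with respect to $\le_{\mathcal F}$ and satisfies $f_\alpha\le_{\mathcal F}f_\beta$ for all $\alpha<\beta<\mathfrak b(\mathcal F)$. $\overline{\mathbb N}=\mathbb N\cup\{\infty\}$ is the one-point compactification of $\mathbb N$. $\overline{\mathbb N}^{\uparrow\mathbb N}$ is the (compact) subspace of the product $\overline{\mathbb N}^{\mathbb N}$ consisting of the nondecreasing $f$ such that $f(n)<f(n+1)$ whenever $f(n)<\infty$. $Q$ is the (countable) set of all $f\in\overline{\mathbb N}^{\uparrow\mathbb N}$ that take the value $\infty$; thus $\overline{\mathbb N}^{\uparrow\mathbb N}=Q\cup\mathbb N^{\uparrow\mathbb N}$. *)

theory Defs
  imports "HOL-Analysis.Analysis"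
begin

unbundle cardinal_syntax

definition almost_subset :: "nat set \<Rightarrow> nat set \<Rightarrow> bool"
  where "almost_subset A B \<longleftrightarrow> finite (A - B)"

definition semifilter :: "nat set set \<Rightarrow> bool" where
  "semifilter F \<longleftrightarrow> F \<noteq> {} \<and> (\<forall>A\<in>F. infinite A) \<and>
     (\<forall>A B. A \<in> F \<longrightarrow> almost_subset A B \<longrightarrow> B \<in> F)"

definition le_mod :: "nat set set \<Rightarrow> (nat \<Rightarrow> nat) \<Rightarrow> (nat \<Rightarrow> nat) \<Rightarrow> bool"
  where "le_mod F f g \<longleftrightarrow> {n. f n \<le> g n} \<in> F"

definition bounded_mod :: "nat set set \<Rightarrow> (nat \<Rightarrow> nat) set \<Rightarrow> bool"
  where "bounded_mod F Y \<longleftrightarrow> (\<exists>g. \<forall>f\<in>Y. le_mod F f g)"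

(* Cardinals are well-orders in the sense of HOL.BNF_Cardinal_Order_Relation, determined up
   to isomorphism =o. The minimum is attained, see bounding_number_attained below. *)
definition bounding_number :: "nat set set \<Rightarrow> (nat \<Rightarrow> nat) rel" where
  "bounding_number F = card_of (SOME B. \<not> bounded_mod F B \<and>
     (\<forall>B'. \<not> bounded_mod F B' \<longrightarrow> |B| \<le>o |B'| ))"

lemma unbounded_mod_UNIV:
  assumes "semifilter F"
  shows "\<not> bounded_mod F UNIV"
proof
  assume "bounded_mod F UNIV"
  then obtain g where "\<And>f. le_mod F f g" by (auto simp: bounded_mod_def)
  then have "le_mod F (\<lambda>n. g n + 1) g" .
  then have "{n. g n + 1 \<le> g n} \<in> F" unfolding le_mod_def .
  then have "infinite {n. g n + 1 \<le> g n}" using assms unfolding semifilter_def by blast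
  then show False by simp
qed

lemma bounding_number_attained:
  assumes "semifilter F"
  shows "\<exists>B. bounding_number F = |B| \<and> \<not> bounded_mod F B \<and>
           (\<forall>B'. \<not> bounded_mod F B' \<longrightarrow> |B| \<le>o |B'| )"
proof -
  let ?R = "card_of ` {B. \<not> bounded_mod F B}"
  have "?R \<noteq> {}" using unbounded_mod_UNIV[OF assms] by blast
  moreover have "\<forall>r\<in>?R. Well_order r" using card_of_Well_order by blast
  ultimately obtain r where "r \<in> ?R" "\<forall>r'\<in>?R. r \<le>o r'"
    using exists_minim_Well_order[of ?R] by blast
  then have "\<exists>B. \<not> bounded_mod F B \<and> (\<forall>B'. \<not> bounded_mod F B' \<longrightarrow> |B| \<le>o |B'| )"
    by auto
  from someI_ex[OF this] show ?thesis unfolding bounding_number_def by blast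
qed

(* The ordinals below b(F) are the elements of the field of a well-order r of order type b(F);
   r is arbitrary up to isomorphism. *)
definition b_scale :: "nat set set \<Rightarrow> 'i rel \<Rightarrow> ('i \<Rightarrow> nat \<Rightarrow> nat) \<Rightarrow> bool" where
  "b_scale F r f \<longleftrightarrow> r =o bounding_number F \<and>
     (\<forall>\<alpha>\<in>Field r. strict_mono (f \<alpha>)) \<and>
     \<not> bounded_mod F (f ` Field r) \<and>
     (\<forall>\<alpha> \<beta>. (\<alpha>, \<beta>) \<in> r \<longrightarrow> \<alpha> \<noteq> \<beta> \<longrightarrow> le_mod F (f \<alpha>) (f \<beta>))"

(* The library's order topology on enat is the one-point compactification of the discrete
   naturals (cf. open_enat_iff), and nat => enat carries the product topology. *)
definition inc_enat :: "(nat \<Rightarrow> enat) set" where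
  "inc_enat = {f. mono f \<and> (\<forall>n. f n < \<infinity> \<longrightarrow> f n < f (Suc n))}"

definition Qinf :: "(nat \<Rightarrow> enat) set"
  where "Qinf = {f \<in> inc_enat. \<exists>n. f n = \<infinity>}"

definition embed_enat :: "(nat \<Rightarrow> nat) \<Rightarrow> nat \<Rightarrow> enat"
  where "embed_enat f = (\<lambda>n. enat (f n))"

lemma inc_enat_decomp: "inc_enat = Qinf \<union> embed_enat ` {f. strict_mono f}"
proof (intro equalityI subsetI)
  fix f assume f: "f \<in> inc_enat"
  show "f \<in> Qinf \<union> embed_enat ` {f. strict_mono f}"
  proof (cases "\<exists>n. f n = \<infinity>")
    case False
    then have eq: "f n = enat (the_enat (f n))" for n
      using False by (metis enat.exhaust the_enat.simps)
    have "the_enat (f n) < the_enat (f (Suc n))" for n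
    proof -
      have "f n < f (Suc n)" using f False by (auto simp: inc_enat_def)
      then show ?thesis using eq[of n] eq[of "Suc n"] by (metis enat_ord_simps(2))
    qed
    then have "strict_mono (\<lambda>n. the_enat (f n))" by (simp add: strict_mono_Suc_iff)
    moreover have "f = embed_enat (\<lambda>n. the_enat (f n))"
      unfolding embed_enat_def using eq by blast
    ultimately show ?thesis by blast
  qed (use f in \<open>auto simp: Qinf_def\<close>)
next
  fix f assume "f \<in> Qinf \<union> embed_enat ` {f. strict_mono f}"
  then show "f \<in> inc_enat"
    by (auto simp: Qinf_def inc_enat_def embed_enat_def strict_mono_less strict_mono_less_eq
        intro!: monoI)
qed

definition perfect_in :: "'a::topological_space set \<Rightarrow> 'a set \<Rightarrow> bool" where
  "perfect_in T P \<longleftrightarrow> P \<noteq> {} \<and> closedin (top_of_set T) P \<and> \<not> (\<exists>x. x isolated_in P)"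

definition sigma_compact :: "'a::topological_space set \<Rightarrow> bool" where
  "sigma_compact X \<longleftrightarrow> (\<exists>K. countable K \<and> (\<forall>C\<in>K. compact C) \<and> X = \<Union>K)"

end

theory Submission
  imports Defs
begin

text \<open>
  Every closed \<open>K \<subseteq> X\<close> is countable. Indeed, some \<open>f \<alpha>\<close> is not below a given \<open>g\<close> modulo \<open>F\<close>,
  hence no later member of the scale lies pointwise below \<open>g\<close>, and fewer than \<open>b(F)\<close> members do.
  If \<open>K\<close> were uncountable, then, \<open>Qinf\<close> being countable, the finite-valued members
  of \<open>K\<close> would form an uncountable closed subset of the Baire space. A Cantor scheme
  in it has finitely many nodes on each level, so its branches are continuum many functions below a single \<open>g\<close>, although \<open>b(F)\<close> is at most the
  continuum. Perfect sets are uncountable; and if \<open>X\<close> were \<open>\<sigma>\<close>-compact, it would be countable, while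
  countable families are bounded modulo \<open>F\<close>.
\<close>

section \<open>Topology of the increasing extended sequences\<close>

lemma countable_Qinf: "countable Qinf"
proof (rule countable_subset)
  show "Qinf \<subseteq> range (\<lambda>(xs :: enat list) i. if i < length xs then xs ! i else \<infinity>)"
  proof
    fix f assume "f \<in> Qinf"
    then obtain n where n: "f n = \<infinity>" and "mono f"
      by (auto simp: Qinf_def inc_enat_def)
    \<comment> \<open>By monotonicity \<infinity> persists, so the finite list of earlier values
      determines \<open>f\<close>.\<close>
    have "f i = \<infinity>" if "n \<le> i" for i
      using monoD[OF \<open>mono f\<close> that] n by simp
    then have "f = (\<lambda>i. if i < length (map f [0..<n]) then map f [0..<n] ! i else \<infinity>)"
      by auto
    then show "f \<in> range (\<lambda>(xs :: enat list) i. if i < length xs then xs ! i else \<infinity>)"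
      by blast
  qed
qed auto

lemma inc_enat_alt: "inc_enat = (\<Inter>n. {f. f n \<le> f (Suc n)} \<inter> {f. f n = \<infinity> \<or> f n < f (Suc n)})"
  by (auto simp: inc_enat_def mono_iff_le_Suc) (metis enat.distinct)

lemma open_coordinate:
  fixes U :: "'b::topological_space set"
  assumes "open U"
  shows "open {f :: 'a \<Rightarrow> 'b. f i \<in> U}"
  using open_vimage[OF assms continuous_on_product_coordinates] by (simp add: vimage_def)

lemma closed_inc_enat: "closed inc_enat"
proof -
  have cont: "continuous_on UNIV (\<lambda>f :: nat \<Rightarrow> enat. f n)" for n
    by simp
  have "open {f :: nat \<Rightarrow> enat. f n \<noteq> \<infinity> \<and> f (Suc n) \<le> f n}" for n
  proof -
    \<comment> \<open>Splitting by the finite value \<open>k\<close> of \<open>f n\<close> leaves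
      two one-coordinate conditions, each open: \<open>{enat k}\<close> is a singleton of a finite
      point, and \<open>{..enat k}\<close> avoids \<infinity>.\<close>
    have "{f :: nat \<Rightarrow> enat. f n \<noteq> \<infinity> \<and> f (Suc n) \<le> f n} =
        (\<Union>k. {f. f n \<in> {enat k}} \<inter> {f. f (Suc n) \<in> {..enat k}})"
      by auto
    moreover have "open {..enat k}" for k
      by (simp add: open_enat_iff)
    ultimately show ?thesis
      by (simp only:) (intro open_UN ballI open_Int open_coordinate open_enat)
  qed
  then have "closed {f :: nat \<Rightarrow> enat. f n = \<infinity> \<or> f n < f (Suc n)}" for n
    unfolding closed_def by (simp add: Collect_neg_eq[symmetric] not_less)
  then show ?thesis
    unfolding inc_enat_alt by (intro closed_INT ballI closed_Int closed_Collect_le cont)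
qed

lemma continuous_embed_enat: "continuous_on UNIV embed_enat"
  unfolding embed_enat_def
proof (rule continuous_on_coordinatewise_then_product)
  have "continuous_on UNIV enat" by (simp add: continuous_on_open_vimage open_discrete)
  then show "continuous_on UNIV (\<lambda>f. enat (f i))" for i :: nat
    by (rule continuous_on_compose2[OF _ continuous_on_product_coordinates]) simp
qed

lemma Hausdorff_space_fun_t2: "Hausdorff_space (euclidean :: ('a \<Rightarrow> 'b::t2_space) topology)"
proof -
  have "Hausdorff_space (euclidean :: 'b topology)"
    unfolding Hausdorff_space_def disjnt_def by (auto intro: hausdorff[simplified])
  then have "Hausdorff_space (product_topology (\<lambda>_::'a. euclidean :: 'b topology) UNIV)"
    by (simp add: Hausdorff_space_product_topology)
  then show ?thesis by (simp add: euclidean_product_topology)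
qed

lemma compact_space_enat_fun: "compact_space (euclidean :: ('a \<Rightarrow> enat) topology)"
proof -
  have "compact_space (product_topology (\<lambda>_::'a. euclidean :: enat topology) UNIV)"
    unfolding compact_space_product_topology by (simp add: compact_space_def compact_UNIV)
  then show ?thesis by (simp add: euclidean_product_topology)
qed

text \<open>The full product of copies of \<open>enat\<close> is compact Hausdorff, and there the
  reals inject into every nonempty set that equals its derived set.\<close>

lemma perfect_imp_uncountable:
  assumes "perfect_in inc_enat P"
  shows "uncountable P"
proof
  assume "countable P"
  let ?E = "euclidean :: (nat \<Rightarrow> enat) topology"
  have "closed P"
    using assms closed_inc_enat closedin_closed_trans unfolding perfect_in_def by blast
  have "?E derived_set_of P = P"
  proof
    show "?E derived_set_of P \<subseteq> P"
      using \<open>closed P\<close> by (metis closed_closedin closedin_contains_derived_set)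
    show "P \<subseteq> ?E derived_set_of P"
      using assms unfolding perfect_in_def isolated_in_islimpt_iff islimpt_def derived_set_of_def
      by auto
  qed
  then have "(UNIV :: real set) \<lesssim> P"
    using compact_space_enat_fun Hausdorff_space_fun_t2 assms compact_imp_locally_compact_space
    unfolding perfect_in_def
    by (intro lepoll_perfect_set[of ?E]) auto
  then show False
    using \<open>countable P\<close> countable_lepoll uncountable_UNIV_real by blast
qed

section \<open>Countable families modulo a semifilter\<close>

lemma countable_bounded_mod:
  assumes "semifilter F" "countable Y"
  shows "bounded_mod F Y"
proof (cases "Y = {}")
  case True then show ?thesis by (simp add: bounded_mod_def)
next
  case False
  then obtain e :: "nat \<Rightarrow> nat \<Rightarrow> nat" where e: "range e = Y"
    using assms(2) by (metis uncountable_def)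
  \<comment> \<open>Diagonal bound: its value at \<open>n\<close> covers the first
    \<open>n + 1\<close> functions, so it dominates \<open>e k\<close> from index \<open>k\<close>
    on. Such a cofinite set contains almost all of any member of \<open>F\<close>, hence is itself
    in \<open>F\<close>.\<close>
  let ?g = "\<lambda>n. Max ((\<lambda>k. e k n) ` {..n})"
  have "le_mod F (e k) ?g" for k
  proof -
    obtain A where "A \<in> F" using assms(1) by (auto simp: semifilter_def)
    have "e k n \<le> ?g n" if "k \<le> n" for n
      using that by (intro Max_ge) auto
    then have "A - {n. e k n \<le> ?g n} \<subseteq> {..<k}"
      by (auto simp: not_less)
    then have "almost_subset A {n. e k n \<le> ?g n}"
      unfolding almost_subset_def using finite_subset by blast
    then show ?thesis
      using assms(1) \<open>A \<in> F\<close> unfolding le_mod_def semifilter_def by blast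
  qed
  then show ?thesis unfolding bounded_mod_def using e by blast
qed

section \<open>Cantor schemes of sequences\<close>

lemma uncountable_split:
  fixes A :: "(nat \<Rightarrow> 'b::countable) set"
  assumes "uncountable A"
  obtains k u v where "u \<noteq> v" "uncountable {a \<in> A. a k = u}" "uncountable {a \<in> A. a k = v}"
proof -
  have "\<exists>k u v. u \<noteq> v \<and> uncountable {a \<in> A. a k = u} \<and> uncountable {a \<in> A. a k = v}"
  proof (rule ccontr)
    assume "\<not> ?thesis"
    then have "\<exists>v. \<forall>u. u \<noteq> v \<longrightarrow> countable {a \<in> A. a k = u}" for k
      by blast
    then have "\<exists>v. \<forall>k u. u \<noteq> v k \<longrightarrow> countable {a \<in> A. a k = u}"
      by (intro choice) blast
    then obtain v where v: "\<And>k u. u \<noteq> v k \<Longrightarrow> countable {a \<in> A. a k = u}"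
      by blast
    \<comment> \<open>If each coordinate \<open>k\<close> has only one value \<open>v k\<close> with
      an uncountable fibre, then every sequence other than \<open>v\<close> lies in one of countably
      many countable fibres.\<close>
    have "A \<subseteq> {v} \<union> (\<Union>k. \<Union>u \<in> - {v k}. {a \<in> A. a k = u})"
      by auto
    moreover have "countable ({v} \<union> (\<Union>k. \<Union>u \<in> - {v k}. {a \<in> A. a k = u}))"
      using v by (intro countable_Un countable_UN) auto
    ultimately show False using assms countable_subset by blast
  qed
  then show thesis using that by blast
qed

lemma uncountable_fix_coordinate:
  fixes A :: "(nat \<Rightarrow> 'b::countable) set"
  assumes "uncountable A"
  obtains u where "uncountable {a \<in> A. a n = u}"
proof -
  have "A = (\<Union>u. {a \<in> A. a n = u})" by auto
  then have "\<not> (\<forall>u. countable {a \<in> A. a n = u})"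
    using assms countable_UN[of UNIV "\<lambda>u. {a \<in> A. a n = u}"] by fastforce
  then show thesis using that by blast
qed

text \<open>One step of the scheme. Separation at \<open>k\<close> makes distinct branches differ;
  freezing coordinate \<open>n\<close> in each half is what will bound the branches.\<close>

lemma uncountable_step:
  fixes A :: "(nat \<Rightarrow> 'b::countable) set"
  assumes "uncountable A"
  shows "\<exists>p. (\<forall>b. uncountable (p b) \<and> p b \<subseteq> A \<and> (\<forall>x\<in>p b. \<forall>y\<in>p b. x n = y n)) \<and>
    (\<exists>k. \<forall>x\<in>p True. \<forall>y\<in>p False. x k \<noteq> y k)"
proof -
  obtain k u v where k: "u \<noteq> v" "uncountable {a \<in> A. a k = u}" "uncountable {a \<in> A. a k = v}"
    using uncountable_split[OF assms] .
  obtain s where s: "uncountable {a \<in> {a \<in> A. a k = u}. a n = s}"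
    using uncountable_fix_coordinate[OF k(2)] .
  obtain t where t: "uncountable {a \<in> {a \<in> A. a k = v}. a n = t}"
    using uncountable_fix_coordinate[OF k(3)] .
  show ?thesis
    using s t k(1)
    by (intro exI[of _ "\<lambda>b. if b then {a \<in> {a \<in> A. a k = u}. a n = s} else {a \<in> {a \<in> A. a k = v}. a n = t}"])
      (auto intro!: exI[of _ k])
qed

lemma closed_funI:
  fixes Z :: "(nat \<Rightarrow> 'b::first_countable_topology) set"
  assumes "closed Z" and app: "\<And>n. \<exists>w\<in>Z. \<forall>i<n. w i = z i"
  shows "z \<in> Z"
proof -
  obtain w where w: "\<And>n. w n \<in> Z" "\<And>n i. i < n \<Longrightarrow> w n i = z i"
    using app by metis
  have "(\<lambda>n. w n i) \<longlonglongrightarrow> z i" for i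
    using w(2) by (intro tendsto_eventually eventually_mono[OF eventually_gt_at_top[of i]])
  then have "limitin (product_topology (\<lambda>_. euclidean) UNIV) w z sequentially"
    by (simp add: limitin_componentwise)
  then have "w \<longlonglongrightarrow> z"
    by (simp add: euclidean_product_topology)
  then show ?thesis using closed_sequentially[OF assms(1)] w(1) by blast
qed

lemma uncountable_closed_bounded_copy:
  fixes Z :: "(nat \<Rightarrow> nat) set"
  assumes "closed Z" "uncountable Z"
  obtains h :: "(nat \<Rightarrow> bool) \<Rightarrow> nat \<Rightarrow> nat" and g
  where "inj h" "range h \<subseteq> Z" "\<And>x. h x \<le> g"
proof -
  let ?Q = "\<lambda>n A p. (\<forall>b. uncountable (p b) \<and> p b \<subseteq> A \<and> (\<forall>x\<in>p b. \<forall>y\<in>p b. x n = y n)) \<and>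
    (\<exists>k. \<forall>x\<in>p True. \<forall>y\<in>p False. x k \<noteq> y k)"
  \<comment> \<open>The choice depends on \<open>n\<close> and \<open>A\<close> alone, so branches
    with a common prefix share their nodes.\<close>
  define p :: "nat \<Rightarrow> (nat \<Rightarrow> nat) set \<Rightarrow> bool \<Rightarrow> (nat \<Rightarrow> nat) set"
    where "p n A = (SOME p. ?Q n A p)" for n A
  have Q: "?Q n A (p n A)" if "uncountable A" for n A
    unfolding p_def using uncountable_step[OF that] by (rule someI_ex)
  have p: "uncountable (p n A b)" "p n A b \<subseteq> A"
    "x \<in> p n A b \<Longrightarrow> y \<in> p n A b \<Longrightarrow> x n = y n"
    "\<exists>k. \<forall>x\<in>p n A True. \<forall>y\<in>p n A False. x k \<noteq> y k" if "uncountable A" for n A b x y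
    using Q[OF that, of n] by blast+
  \<comment> \<open>\<open>node x n\<close> is reached by the first \<open>n\<close> bits of
    \<open>x\<close>; passing to level \<open>Suc n\<close> freezes coordinate
    \<open>n\<close>.\<close>
  define node where "node x = rec_nat Z (\<lambda>n A. p n A (x n))" for x
  have node_0 [simp]: "node x 0 = Z" and node_Suc [simp]: "node x (Suc n) = p n (node x n) (x n)" for x n
    by (simp_all add: node_def)
  have unc: "uncountable (node x n)" for x n
    by (induction n) (simp_all add: assms(2) p(1))
  have anti: "node x n \<subseteq> node x m" if "m \<le> n" for x m n
    using that
  proof (induction n rule: dec_induct)
    case (step n) then show ?case using p(2)[OF unc, of n x n "x n"] by simp
  qed simp
  define c where "c A = (SOME a. a \<in> A)" for A :: "(nat \<Rightarrow> nat) set"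
  have c: "c (node x n) \<in> node x n" for x n
    unfolding c_def using unc[of x n] by (metis countable_empty some_in_eq)
  \<comment> \<open>Coordinate \<open>n\<close> is constant on \<open>node x (Suc n)\<close>, so any
    of its points gives the value of the branch there.\<close>
  define h where "h x n = c (node x (Suc n)) n" for x n
  have h: "a k = h x k" if "a \<in> node x n" "k < n" for a x n k
  proof -
    have "a \<in> node x (Suc k)" using anti[of "Suc k" n x] that by auto
    then show ?thesis unfolding h_def using p(3)[OF unc, of _ k x k "x k"] c[of x "Suc k"] by simp
  qed
  \<comment> \<open>Each node has at most two successors, so every level is finite and the maximum
    defining \<open>g\<close> exists.\<close>
  have fin: "finite (range (\<lambda>x. node x n))" for n
  proof (induction n)
    case (Suc n)
    have "range (\<lambda>x. node x (Suc n)) \<subseteq> (\<lambda>(A, b). p n A b) ` (range (\<lambda>x. node x n) \<times> UNIV)"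
      by auto
    then show ?case by (rule finite_subset) (use Suc in auto)
  qed simp
  define g where "g n = Max ((\<lambda>A. c A n) ` range (\<lambda>x. node x (Suc n)))" for n
  have "h x \<le> g" for x
    unfolding le_fun_def h_def g_def by (intro allI Max_ge finite_imageI fin imageI rangeI)
  moreover have "range h \<subseteq> Z"
  proof safe
    fix x show "h x \<in> Z"
      using assms(1)
    proof (rule closed_funI)
      \<comment> \<open>The chosen point of \<open>node x n\<close> lies in \<open>Z\<close> and has
        the first \<open>n\<close> frozen coordinates in common with the branch.\<close>
      show "\<exists>w\<in>Z. \<forall>i<n. w i = h x i" for n
        using c[of x n] anti[of 0 n x] h[of _ x n] by auto
    qed
  qed
  moreover have "inj h"
  proof (rule injI, rule ccontr)
    fix x y :: "nat \<Rightarrow> bool" assume eq: "h x = h y" and "x \<noteq> y"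
    then have ex: "\<exists>n. x n \<noteq> y n" by auto
    \<comment> \<open>Up to the first differing bit both branches pass through the same nodes; there
      they enter opposite halves.\<close>
    define n where "n = (LEAST n. x n \<noteq> y n)"
    have n: "x n \<noteq> y n" unfolding n_def using ex by (rule LeastI_ex)
    have less: "x i = y i" if "i < n" for i
      using not_less_Least[of i "\<lambda>n. x n \<noteq> y n"] that unfolding n_def by blast
    have same: "node x m = node y m" if "m \<le> n" for m
      using that by (induction m) (auto simp: less)
    have "\<exists>k. \<forall>a\<in>node x (Suc n). \<forall>b\<in>node y (Suc n). a k \<noteq> b k"
      using p(4)[OF unc, of n x n] n same[of n] by (cases "x n"; cases "y n") (auto, metis)
    then obtain k where k: "\<And>a b. a \<in> node x (Suc n) \<Longrightarrow> b \<in> node y (Suc n) \<Longrightarrow> a k \<noteq> b k"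
      by blast
    \<comment> \<open>Deep enough to lie inside the separated halves and to have coordinate
      \<open>k\<close> frozen to the branch values.\<close>
    let ?m = "Suc (max n k)"
    have "c (node x ?m) k \<noteq> c (node y ?m) k"
      using k c[of x ?m] c[of y ?m] anti[of "Suc n" ?m x] anti[of "Suc n" ?m y] by (metis Suc_le_mono max.cobounded1 subsetD)
    then show False using h[OF c[of x ?m], of k] h[OF c[of y ?m], of k] eq by (simp add: less_Suc_eq_le)
  qed
  ultimately show thesis using that by blast
qed

section \<open>Cardinality of closed subsets of the scale with \<open>Qinf\<close>\<close>

lemma bounding_number_le_continuum:
  assumes "semifilter F"
  shows "bounding_number F \<le>o |UNIV :: (nat \<Rightarrow> bool) set|"
proof -
  obtain B where B: "bounding_number F = |B|"
    using bounding_number_attained[OF assms] by blast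
  \<comment> \<open>The characteristic function of the graph of \<open>f\<close>, coded by
    pairing.\<close>
  let ?G = "\<lambda>(f :: nat \<Rightarrow> nat) m. f (fst (prod_decode m)) = snd (prod_decode m)"
  have "inj ?G"
  proof (rule injI, rule ext)
    fix f g n assume "?G f = ?G g"
    from fun_cong[OF this, of "prod_encode (n, f n)"] show "f n = g n" by simp
  qed
  then have "|B| \<le>o |UNIV :: (nat \<Rightarrow> bool) set|"
    by (intro card_of_ordLeqI[of ?G]) (auto intro: inj_on_subset)
  then show ?thesis using B by simp
qed

lemma b_scale_bounded_part_small:
  assumes "semifilter F" "b_scale F r f"
  shows "|{s \<in> f ` Field r. s \<le> g}| <o bounding_number F"
proof -
  have ro: "r =o bounding_number F" and nb: "\<not> bounded_mod F (f ` Field r)"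
    and le: "\<And>\<alpha> \<beta>. (\<alpha>, \<beta>) \<in> r \<Longrightarrow> \<alpha> \<noteq> \<beta> \<Longrightarrow> le_mod F (f \<alpha>) (f \<beta>)"
    using assms(2) by (auto simp: b_scale_def)
  have up: "le_mod F s g" if "le_mod F s t" "t \<le> g" for s t
  proof -
    have "almost_subset {n. s n \<le> t n} {n. s n \<le> g n}"
      using le_funD[OF that(2)] order_trans unfolding almost_subset_def
      by (metis (no_types, lifting) Collect_mono Diff_eq_empty_iff finite.emptyI)
    then show ?thesis using that(1) assms(1) unfolding le_mod_def semifilter_def by blast
  qed
  have "UNIV \<in> F"
    using assms(1) unfolding semifilter_def almost_subset_def by (metis Diff_UNIV finite.emptyI ex_in_conv)
  then have above: "le_mod F s g" if "s \<le> g" for s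
    using that by (simp add: le_mod_def le_fun_def)
  have r: "Card_order r"
    using ro bounding_number_attained[OF assms(1)] by (metis card_of_Card_order Card_order_ordIso)
  then have "wo_rel r" using card_order_on_well_order_on by (simp add: wo_rel_def)
  obtain \<alpha> where \<alpha>: "\<alpha> \<in> Field r" "\<not> le_mod F (f \<alpha>) g"
    using nb unfolding bounded_mod_def by blast
  \<comment> \<open>Otherwise \<open>f \<alpha>\<close> would be below \<open>f \<beta>\<close>
    modulo \<open>F\<close>, or equal to it, and hence below \<open>g\<close> modulo
    \<open>F\<close>.\<close>
  have "\<beta> \<in> underS r \<alpha>" if "\<beta> \<in> Field r" "f \<beta> \<le> g" for \<beta>
  proof (rule ccontr)
    assume "\<beta> \<notin> underS r \<alpha>"
    then have "\<alpha> = \<beta> \<or> (\<alpha>, \<beta>) \<in> r \<and> \<alpha> \<noteq> \<beta>"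
      using wo_rel.TOTALS[OF \<open>wo_rel r\<close>] that(1) \<alpha>(1) by (auto simp: underS_def)
    then show False
    proof
      assume "\<alpha> = \<beta>"
      then show False using above that(2) \<alpha>(2) by blast
    next
      assume "(\<alpha>, \<beta>) \<in> r \<and> \<alpha> \<noteq> \<beta>"
      then show False using up[OF le that(2)] \<alpha>(2) by blast
    qed
  qed
  then have "{s \<in> f ` Field r. s \<le> g} \<subseteq> f ` underS r \<alpha>" by blast
  \<comment> \<open>As \<open>r\<close> is a cardinal order, its proper initial segment
    \<open>underS r \<alpha>\<close> has smaller cardinality.\<close>
  then have "|{s \<in> f ` Field r. s \<le> g}| \<le>o |underS r \<alpha>|"
    by (meson card_of_image card_of_mono1 ordLeq_transitive)
  then show ?thesis
    using card_of_underS[OF r \<alpha>(1)] ro by (meson ordLeq_ordLess_trans ordLess_ordIso_trans)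
qed

lemma b_scale_closed_subset_countable:
  assumes "semifilter F" "b_scale F r f" "closed K" "K \<subseteq> embed_enat ` (f ` Field r) \<union> Qinf"
  shows "countable K"
proof (rule ccontr)
  assume unc: "uncountable K"
  let ?Z = "embed_enat -` K"
  have "inj embed_enat" by (auto simp: inj_def embed_enat_def fun_eq_iff)
  have disj: "embed_enat z \<notin> Qinf" for z by (simp add: Qinf_def embed_enat_def)
  \<comment> \<open>Pulling back along \<open>embed_enat\<close> discards only points of the
    countable set \<open>Qinf\<close>.\<close>
  have "K \<subseteq> embed_enat ` ?Z \<union> Qinf" using assms(4) by auto
  then have "uncountable ?Z"
    using unc countable_Qinf by (meson countable_Un countable_image countable_subset)
  moreover have "closed ?Z" using closed_vimage[OF assms(3) continuous_embed_enat] .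
  ultimately obtain h :: "(nat \<Rightarrow> bool) \<Rightarrow> nat \<Rightarrow> nat" and g
    where h: "inj h" "range h \<subseteq> ?Z" "\<And>x. h x \<le> g"
    using uncountable_closed_bounded_copy by metis
  have "?Z \<subseteq> f ` Field r"
    using assms(4) disj inj_image_mem_iff[OF \<open>inj embed_enat\<close>] by blast
  then have "range h \<subseteq> {s \<in> f ` Field r. s \<le> g}"
    using h(2,3) by fast
  then have "|UNIV :: (nat \<Rightarrow> bool) set| \<le>o |{s \<in> f ` Field r. s \<le> g}|"
    using h(1) by (intro card_of_ordLeqI[of h]) auto
  then have "|UNIV :: (nat \<Rightarrow> bool) set| <o |UNIV :: (nat \<Rightarrow> bool) set|"
    using b_scale_bounded_part_small[OF assms(1,2)] bounding_number_le_continuum[OF assms(1)]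
    by (meson ordLeq_ordLess_trans ordLess_ordLeq_trans)
  then show False using ordLess_irreflexive by blast
qed

theorem theorem2p20:
  fixes F :: "nat set set" and r :: "'i rel" and f :: "'i \<Rightarrow> nat \<Rightarrow> nat"
    and S :: "(nat \<Rightarrow> nat) set" and X :: "(nat \<Rightarrow> enat) set"
  assumes "semifilter F"
    and "b_scale F r f"
    and "S = f ` Field r"
    and "X = embed_enat ` S \<union> Qinf"
  shows "\<not> (\<exists>P. perfect_in inc_enat P \<and> P \<subseteq> X) \<and> \<not> sigma_compact X"
proof
  have countable: "countable K" if "closed K" "K \<subseteq> X" for K
    using b_scale_closed_subset_countable[OF assms(1,2)] that assms(3,4) by blast
  show "\<not> (\<exists>P. perfect_in inc_enat P \<and> P \<subseteq> X)"
    using countable perfect_imp_uncountable closedin_closed_trans closed_inc_enat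
    unfolding perfect_in_def by metis
  show "\<not> sigma_compact X"
  proof
    assume "sigma_compact X"
    then obtain \<K> where K: "countable \<K>" "\<And>C. C \<in> \<K> \<Longrightarrow> compact C" "X = \<Union>\<K>"
      unfolding sigma_compact_def by blast
    \<comment> \<open>Compact sets in a Hausdorff space are closed, so the first claim makes every
      piece countable.\<close>
    have "closed C" if "C \<in> \<K>" for C
      using compactin_imp_closedin[OF Hausdorff_space_fun_t2] K(2)[OF that] by simp
    then have "countable X"
      using K(1,3) countable countable_UN[of \<K> "\<lambda>C. C"] by (simp add: Sup_upper)
    then have "countable S"
      using assms(4) by (auto intro!: countable_image_inj_on[of embed_enat] simp: inj_on_def embed_enat_def fun_eq_iff)
    then show False
      using countable_bounded_mod assms(1,2,3) unfolding b_scale_def by blast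
  qed
qed

end
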